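(* For every integer $k\ge2$, the harmonic labeling of the graph $\langle(0,k)\rangle$ given by labeling each vertex $n\in\mathbb{Z}$ by $n$ is spanned by the finite set $\{0,1\}$ consisting of the vertices labeled $0$ and $1$.
   Context: A harmonic labeling of an infinite simple graph $G$ of bounded degree with vertex set $V_G$ is a bijection $\ell:V_G\to\mathbb{Z}$ such that $\ell(v)=\frac{1}{\deg(v)}\sum_{w\sim v}\ell(w)$ for every $v\in V_G$. The graph $\langle(0,k)\rangle$ has vertex set $\mathbb{Z}$ and edges $\{n,n+1\}$ for all $n\in\mathbb{Z}$ together with $\{sk,(s+1)k\}$ for all $s\in\mathbb{Z}$. A set $V'\subset V_G$ spans a harmonic labeling $\ell$ of $G$ (is a labeling spanning set) if the values of $\ell$ on $V'$ completely determine $\ell$ by the harmonic property, i.e. if every function $f:V_G\to\mathbb{R}$ satisfying $f(v)=\frac{1}{\deg(v)}\sum_{w\sim v}f(w)$ for all $v\in V_G$ and $f|_{V'}=\ell|_{V'}$ equals $\ell$. *)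

theory Defs
  imports Complex_Main
begin

text \<open>A graph is given by a vertex set \<open>V\<close> and a set \<open>E\<close> of edges,
  each edge being the set of its two endpoints.\<close>

definition simple_graph :: "'a set \<Rightarrow> 'a set set \<Rightarrow> bool" where
  "simple_graph V E \<longleftrightarrow> E \<subseteq> {{u, v} | u v. u \<in> V \<and> v \<in> V \<and> u \<noteq> v}"

definition neighbours :: "'a set set \<Rightarrow> 'a \<Rightarrow> 'a set" where
  "neighbours E v = {w. {v, w} \<in> E}"

definition degree :: "'a set set \<Rightarrow> 'a \<Rightarrow> nat" where
  "degree E v = card (neighbours E v)"

text \<open>Finiteness of the neighbourhoods is required explicitly, as \<open>card\<close> of an infinite set is 0.\<close>

definition bounded_degree :: "'a set \<Rightarrow> 'a set set \<Rightarrow> bool" where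
  "bounded_degree V E \<longleftrightarrow> (\<exists>D. \<forall>v\<in>V. finite (neighbours E v) \<and> degree E v \<le> D)"

definition harmonic :: "'a set \<Rightarrow> 'a set set \<Rightarrow> ('a \<Rightarrow> real) \<Rightarrow> bool" where
  "harmonic V E f \<longleftrightarrow>
     (\<forall>v\<in>V. f v = 1 / real (degree E v) * (\<Sum>w\<in>neighbours E v. f w))"

definition harmonic_labeling :: "'a set \<Rightarrow> 'a set set \<Rightarrow> ('a \<Rightarrow> int) \<Rightarrow> bool" where
  "harmonic_labeling V E l \<longleftrightarrow>
     infinite V \<and> simple_graph V E \<and> bounded_degree V E \<and>
     bij_betw l V UNIV \<and> harmonic V E (\<lambda>v. real_of_int (l v))"

text \<open>Functions are total on the type, so values outside \<open>V\<close> are left unconstrained.\<close>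

definition spans_labeling :: "'a set \<Rightarrow> 'a set set \<Rightarrow> ('a \<Rightarrow> int) \<Rightarrow> 'a set \<Rightarrow> bool" where
  "spans_labeling V E l V' \<longleftrightarrow> V' \<subseteq> V \<and>
     (\<forall>f :: 'a \<Rightarrow> real. harmonic V E f \<longrightarrow> (\<forall>v\<in>V'. f v = real_of_int (l v)) \<longrightarrow>
        (\<forall>v\<in>V. f v = real_of_int (l v)))"

text \<open>The edges of the graph \<open>\<langle>(0, k)\<rangle>\<close>, whose vertex set is \<open>UNIV :: int set\<close>.\<close>

definition chord_edges :: "int \<Rightarrow> int set set" where
  "chord_edges k = {{n, n + 1} | n. True} \<union> {{s * k, (s + 1) * k} | s. True}"

end

theory Submission
  imports Defs
begin

text \<open>Write \<open>D n = f (n + 1) - f n\<close> for a harmonic function \<open>f\<close> on \<open>\<langle>(0, k)\<rangle>\<close>. A vertex that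
  is not a multiple of \<open>k\<close> has only its two neighbours on the line, so \<open>D\<close> does not change there
  and \<open>f\<close> is affine, with slope \<open>d\<^sub>s\<close>, on each block \<open>[s k, (s + 1) k]\<close>
  (lemma \<open>affine_on_block\<close>). At the vertex \<open>s k\<close> the two path edges contribute
  \<open>d\<^sub>s - d\<^sub>s\<^sub>-\<^sub>1\<close> to the Laplacian, and the two chords, each spanning a whole block, contribute
  \<open>k (d\<^sub>s - d\<^sub>s\<^sub>-\<^sub>1)\<close>. Harmonicity thus gives \<open>(1 + k) (d\<^sub>s - d\<^sub>s\<^sub>-\<^sub>1) = 0\<close>, so consecutive slopes
  agree and \<open>f\<close> is affine on all of the integers. Conversely affine functions are harmonic, since
  the neighbours of each vertex lie symmetrically around it. An affine function is determined by
  its values at \<open>0\<close> and \<open>1\<close>.\<close>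

lemma chord_edge_iff:
  "{v, w} \<in> chord_edges k \<longleftrightarrow>
     w = v + 1 \<or> w = v - 1 \<or> k dvd v \<and> (w = v + k \<or> w = v - k)"
proof -
  have "(\<exists>s. {v, w} = {s * k, (s + 1) * k}) \<longleftrightarrow> k dvd v \<and> (w = v + k \<or> w = v - k)"
  proof
    assume "\<exists>s. {v, w} = {s * k, (s + 1) * k}"
    then show "k dvd v \<and> (w = v + k \<or> w = v - k)"
      by (auto simp: doubleton_eq_iff algebra_simps)
  next
    assume R: "k dvd v \<and> (w = v + k \<or> w = v - k)"
    then obtain t where t: "v = t * k" by (auto simp: dvd_def mult.commute)
    from R consider "w = v + k" | "w = v - k" by blast
    then show "\<exists>s. {v, w} = {s * k, (s + 1) * k}"
    proof cases
      case 1
      then have "{v, w} = {t * k, (t + 1) * k}" by (simp add: t algebra_simps)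
      then show ?thesis by blast
    next
      case 2
      then have "{v, w} = {(t - 1) * k, (t - 1 + 1) * k}" by (auto simp: t algebra_simps)
      then show ?thesis by blast
    qed
  qed
  moreover have "(\<exists>n. {v, w} = {n, n + 1}) \<longleftrightarrow> w = v + 1 \<or> w = v - 1"
    by (auto simp: doubleton_eq_iff intro: exI[of _ "v - 1"])
  ultimately show ?thesis
    by (auto simp: chord_edges_def)
qed

lemma neighbours_chord_edges:
  "neighbours (chord_edges k) v =
     (if k dvd v then {v - 1, v + 1, v - k, v + k} else {v - 1, v + 1})"
  by (auto simp: neighbours_def chord_edge_iff)

lemma simple_graph_chord_edges:
  assumes "k \<noteq> 0"
  shows "simple_graph UNIV (chord_edges k)"
  unfolding simple_graph_def
proof
  fix e assume "e \<in> chord_edges k"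
  then consider n where "e = {n, n + 1}" | s where "e = {s * k, (s + 1) * k}"
    by (auto simp: chord_edges_def)
  then show "e \<in> {{u, v} |u v. u \<in> UNIV \<and> v \<in> UNIV \<and> u \<noteq> v}"
  proof cases
    case (1 n)
    moreover have "n \<noteq> n + 1" by simp
    ultimately show ?thesis by blast
  next
    case (2 s)
    moreover have "s * k \<noteq> (s + 1) * k" using assms by simp
    ultimately show ?thesis by blast
  qed
qed

lemma bounded_degree_chord_edges: "bounded_degree UNIV (chord_edges k)"
  unfolding bounded_degree_def
proof (intro exI[of _ 4] ballI conjI)
  fix v
  have "card {v - 1, v + 1, v - k, v + k} \<le> 4" "card {v - 1, v + 1} \<le> 4"
    by (simp_all add: card_insert_if)
  then show "degree (chord_edges k) v \<le> 4"
    by (simp add: degree_def neighbours_chord_edges)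
qed (simp add: neighbours_chord_edges)

text \<open>For \<open>k \<ge> 2\<close> chords are never parallel to path edges, so all listed neighbours are distinct
  and the degrees are exactly \<open>2\<close> and \<open>4\<close>.\<close>

lemma harmonic_chord_edges_iff:
  fixes f :: "int \<Rightarrow> real"
  assumes "k \<ge> 2"
  shows "harmonic UNIV (chord_edges k) f \<longleftrightarrow>
    (\<forall>v. if k dvd v then 4 * f v = f (v - 1) + f (v + 1) + f (v - k) + f (v + k)
         else 2 * f v = f (v - 1) + f (v + 1))"
proof -
  have "(f v = 1 / real (degree (chord_edges k) v) * (\<Sum>w\<in>neighbours (chord_edges k) v. f w)) \<longleftrightarrow>
     (if k dvd v then 4 * f v = f (v - 1) + f (v + 1) + f (v - k) + f (v + k)
      else 2 * f v = f (v - 1) + f (v + 1))" for v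
  proof -
    have "v - 1 \<notin> {v + 1, v - k, v + k}" "v + 1 \<notin> {v - k, v + k}" "v - k \<noteq> v + k"
      using assms by auto
    then show ?thesis
      by (auto simp: degree_def neighbours_chord_edges card_insert_if field_simps)
  qed
  then show ?thesis
    by (simp add: harmonic_def)
qed

text \<open>The mean value property is a second-order recurrence, so the induction carries two
  consecutive values. The second one also covers the right end \<open>a + k\<close> of the block, where the
  two-neighbour mean value property is no longer assumed.\<close>

lemma affine_on_block:
  fixes f :: "int \<Rightarrow> real"
  assumes mean: "\<And>v. \<not> k dvd v \<Longrightarrow> 2 * f v = f (v - 1) + f (v + 1)"
    and a: "k dvd a" and j: "int j < k"
  shows "f (a + int j) = f a + real j * (f (a + 1) - f a) \<and>
         f (a + int j + 1) = f a + (real j + 1) * (f (a + 1) - f a)"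
  using j
proof (induction j)
  case 0
  then show ?case by simp
next
  case (Suc j)
  have "\<not> k dvd int (Suc j)"
    using Suc.prems zdvd_not_zless by auto
  then have "\<not> k dvd a + int (Suc j)"
    using a dvd_add_right_iff by blast
  from mean[OF this]
  have "2 * f (a + int j + 1) = f (a + int j) + f (a + int (Suc j) + 1)"
    by (simp add: algebra_simps)
  moreover have "a + int (Suc j) = a + int j + 1" by simp
  ultimately show ?case
    using Suc by (simp add: algebra_simps)
qed

lemma harmonic_constant_slope:
  fixes f :: "int \<Rightarrow> real"
  assumes k: "k \<ge> 2" and "harmonic UNIV (chord_edges k) f"
  shows "f (v + 1) - f v = f v - f (v - 1)"
proof -
  have H: "if k dvd v then 4 * f v = f (v - 1) + f (v + 1) + f (v - k) + f (v + k)
           else 2 * f v = f (v - 1) + f (v + 1)" for v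
    using assms harmonic_chord_edges_iff by blast
  have mean: "2 * f v = f (v - 1) + f (v + 1)" if "\<not> k dvd v" for v
    using H[of v] that by simp
  show ?thesis
  proof (cases "k dvd v")
    case False
    then show ?thesis using mean[of v] by simp
  next
    case True
    let ?d = "f (v + 1) - f v" and ?d' = "f (v - k + 1) - f (v - k)"
    \<comment> \<open>The last step of a block: it reaches the next multiple of \<open>k\<close>.\<close>
    define j where "j = nat (k - 1)"
    have j: "int j < k" "int j = k - 1" "real j = of_int k - 1"
      using k by (auto simp: j_def)
    have right: "f (v + k) = f v + of_int k * ?d"
      using affine_on_block[OF mean True j(1)] j by simp
    have "k dvd v - k" using True by simp
    from affine_on_block[OF mean this j(1)]
    have left: "f (v - 1) = f (v - k) + (of_int k - 1) * ?d'"
      "f v = f (v - k) + of_int k * ?d'"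
      using j by simp_all
    have "4 * f v = f (v - 1) + f (v + 1) + f (v - k) + f (v + k)"
      using H[of v] True by simp
    then have "(f (v + 1) - f v) - (f v - f (v - 1)) + (f (v + k) - f v) - (f v - f (v - k)) = 0"
      by simp
    moreover have "f v - f (v - 1) = ?d'"
      using left by (simp add: algebra_simps)
    moreover have "f (v + k) - f v = of_int k * ?d" "f v - f (v - k) = of_int k * ?d'"
      using right left(2) by linarith+
    ultimately have "?d - ?d' + of_int k * ?d - of_int k * ?d' = 0"
      by simp
    then have "(1 + of_int k) * (?d - ?d') = 0"
      by (simp add: algebra_simps)
    moreover have "1 + real_of_int k \<noteq> 0" using k by linarith
    ultimately have "?d = ?d'" by simp
    moreover have "f v - f (v - 1) = ?d'" using left by (simp add: algebra_simps)
    ultimately show ?thesis by simp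
  qed
qed

lemma affine_if_constant_slope:
  fixes f :: "int \<Rightarrow> real"
  assumes "\<And>v. f (v + 1) - f v = f v - f (v - 1)"
  shows "f n = f 0 + of_int n * (f 1 - f 0)"
proof -
  have slope: "f (n + 1) - f n = f 1 - f 0" for n
  proof (induction n rule: int_induct[where k = 0])
    case (step1 i)
    then show ?case using assms[of "i + 1"] by simp
  next
    case (step2 i)
    then show ?case using assms[of i] by simp
  qed simp
  show ?thesis
  proof (induction n rule: int_induct[where k = 0])
    case (step1 i)
    then show ?case using slope[of i] by (simp add: algebra_simps)
  next
    case (step2 i)
    then show ?case using slope[of "i - 1"] by (simp add: algebra_simps)
  qed simp
qed

theorem mainTheorem6:
  fixes k :: int
  assumes "k \<ge> 2"
  shows "harmonic_labeling UNIV (chord_edges k) (\<lambda>n. n) \<and>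
         spans_labeling UNIV (chord_edges k) (\<lambda>n. n) {0, 1}"
proof
  have "harmonic UNIV (chord_edges k) real_of_int"
    using assms by (simp add: harmonic_chord_edges_iff)
  moreover have "bij_betw (\<lambda>n::int. n) UNIV UNIV"
    by (simp add: bij_betw_def)
  ultimately show "harmonic_labeling UNIV (chord_edges k) (\<lambda>n. n)"
    using assms simple_graph_chord_edges[of k] bounded_degree_chord_edges[of k]
    by (simp add: harmonic_labeling_def infinite_UNIV_int)
next
  have "f n = of_int n"
    if "harmonic UNIV (chord_edges k) f" "f 0 = 0" "f 1 = 1" for f :: "int \<Rightarrow> real" and n
    using affine_if_constant_slope[OF harmonic_constant_slope[OF assms that(1)], of n] that
    by simp
  then show "spans_labeling UNIV (chord_edges k) (\<lambda>n. n) {0, 1}"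
    by (simp add: spans_labeling_def)
qed

end
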